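(* Let $\Sigma$ be a sentence or a theory, either first-order or second-order, in the language of set theory, and suppose $V_\kappa\models\Sigma$ for some inaccessible cardinal $\kappa$. Then either $\Sigma$ is a categorical characterization over ${\rm ZFC}_2$ of this model, i.e. $\kappa$ is the only inaccessible cardinal with $V_\kappa\models\Sigma$, or else it is consistent with ${\rm ZFC}_2$ that $\Sigma$ is such a categorical characterization, in the sense that there are inaccessible cardinals $\kappa'<\lambda$ such that $\kappa'$ is the only inaccessible cardinal below $\lambda$ with $V_{\kappa'}\models\Sigma$, so that $\langle V_\lambda,\in\rangle\models{\rm ZFC}_2$ and inside $V_\lambda$ the theory ${\rm ZFC}_2+\Sigma$ categorically characterizes $V_{\kappa'}$.
   Context: ${\rm ZFC}_2$ is second-order ZFC; its models are, up to isomorphism, exactly the structures $\langle V_\kappa,\in\rangle$ with $\kappa$ inaccessible, where $V_\kappa$ is the rank-initial segment of the cumulative hierarchy and second-order quantifiers range over all subsets of $V_\kappa$. *)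

theory Defs
  imports Complex_Main "HOL-Library.Countable_Set" "HOL-Library.Equipollence"
begin

section \<open>The background universe of sets\<close>

text \<open>
  The elements of the type are the sets of the background universe V, and HOL predicates and
  functions on the type play the role of its classes. The axiom of choice is not listed: it follows
  from Hilbert choice in HOL together with replacement.
\<close>

class zfc_universe =
  fixes elts :: "'a \<Rightarrow> 'a set"
  assumes extensionality_ax: "elts x = elts y \<Longrightarrow> x = y"
    and foundation_ax: "elts x \<noteq> {} \<Longrightarrow> \<exists>y\<in>elts x. elts y \<inter> elts x = {}"
    and pairing_ax: "\<exists>z. elts z = {x, y}"
    and union_ax: "\<exists>u. elts u = (\<Union>y\<in>elts x. elts y)"
    and power_ax: "\<exists>p. elts p = {z. elts z \<subseteq> elts x}"
    and infinity_ax: "\<exists>w. (\<exists>e\<in>elts w. elts e = {}) \<and>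
                          (\<forall>y\<in>elts w. \<exists>z\<in>elts w. elts z = insert y (elts y))"
    and separation_ax: "\<exists>b. elts b = {x \<in> elts a. P x}"
    and replacement_ax: "\<exists>b. elts b = f ` elts a"

abbreviation mem :: "'v::zfc_universe \<Rightarrow> 'v \<Rightarrow> bool" where
  "mem x y \<equiv> x \<in> elts y"

definition transitive_set :: "'v::zfc_universe \<Rightarrow> bool" where
  "transitive_set x \<longleftrightarrow> (\<forall>y\<in>elts x. elts y \<subseteq> elts x)"

text \<open>Von Neumann ordinals; the order on ordinals is membership.\<close>

definition ordinal :: "'v::zfc_universe \<Rightarrow> bool" where
  "ordinal \<alpha> \<longleftrightarrow> transitive_set \<alpha> \<and> (\<forall>\<beta>\<in>elts \<alpha>. transitive_set \<beta>)"

definition cardinal :: "'v::zfc_universe \<Rightarrow> bool" where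
  "cardinal \<kappa> \<longleftrightarrow> ordinal \<kappa> \<and> (\<forall>\<alpha>\<in>elts \<kappa>. elts \<alpha> \<prec> elts \<kappa>)"

definition regular :: "'v::zfc_universe \<Rightarrow> bool" where
  "regular \<kappa> \<longleftrightarrow> cardinal \<kappa> \<and> infinite (elts \<kappa>) \<and>
     (\<forall>\<alpha>\<in>elts \<kappa>. \<forall>f. f ` elts \<alpha> \<subseteq> elts \<kappa> \<longrightarrow> (\<exists>\<beta>\<in>elts \<kappa>. f ` elts \<alpha> \<subseteq> elts \<beta>))"

definition strong_limit :: "'v::zfc_universe \<Rightarrow> bool" where
  "strong_limit \<kappa> \<longleftrightarrow> cardinal \<kappa> \<and> (\<forall>\<alpha>\<in>elts \<kappa>. Pow (elts \<alpha>) \<prec> elts \<kappa>)"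

definition inaccessible :: "'v::zfc_universe \<Rightarrow> bool" where
  "inaccessible \<kappa> \<longleftrightarrow> uncountable (elts \<kappa>) \<and> regular \<kappa> \<and> strong_limit \<kappa>"

text \<open>
  The cumulative hierarchy, by the single clause that the stage at \<open>\<alpha>\<close> is the union over
  \<open>\<beta> \<in> \<alpha>\<close> of the power set of the stage at \<open>\<beta>\<close> (see \<open>Vset_iff\<close>). Since membership is
  well-founded, the least solution is the only one.
\<close>

inductive in_Vset :: "'v::zfc_universe \<Rightarrow> 'v \<Rightarrow> bool" where
  "\<beta> \<in> elts \<alpha> \<Longrightarrow> (\<And>y. y \<in> elts x \<Longrightarrow> in_Vset \<beta> y) \<Longrightarrow> in_Vset \<alpha> x"

definition Vset :: "'v::zfc_universe \<Rightarrow> 'v set" where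
  "Vset \<alpha> = {x. in_Vset \<alpha> x}"

lemma Vset_iff: "x \<in> Vset \<alpha> \<longleftrightarrow> (\<exists>\<beta>\<in>elts \<alpha>. elts x \<subseteq> Vset \<beta>)"
  unfolding Vset_def by (subst mem_Collect_eq, subst in_Vset.simps) auto


section \<open>Second-order logic in the language of set theory\<close>

text \<open>
  Relation variables are pairs of an arity and an index; the atom \<open>Rel X xs\<close> applies the relation
  variable \<open>(length xs, X)\<close>. The formulas without \<open>Rel\<close> and \<open>Forall2\<close> are the first-order ones.
\<close>

datatype fm =
    Mem nat nat
  | Eq nat nat
  | Rel nat "nat list"
  | Neg fm
  | And fm fm
  | Forall nat fm
  | Forall2 nat nat fm

abbreviation Or :: "fm \<Rightarrow> fm \<Rightarrow> fm" where "Or \<phi> \<psi> \<equiv> Neg (And (Neg \<phi>) (Neg \<psi>))"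
abbreviation Imp :: "fm \<Rightarrow> fm \<Rightarrow> fm" where "Imp \<phi> \<psi> \<equiv> Neg (And \<phi> (Neg \<psi>))"
abbreviation Iff :: "fm \<Rightarrow> fm \<Rightarrow> fm" where "Iff \<phi> \<psi> \<equiv> And (Imp \<phi> \<psi>) (Imp \<psi> \<phi>)"
abbreviation Exists :: "nat \<Rightarrow> fm \<Rightarrow> fm" where "Exists x \<phi> \<equiv> Neg (Forall x (Neg \<phi>))"

primrec fv1 :: "fm \<Rightarrow> nat set" where
  "fv1 (Mem x y) = {x, y}"
| "fv1 (Eq x y) = {x, y}"
| "fv1 (Rel X xs) = set xs"
| "fv1 (Neg \<phi>) = fv1 \<phi>"
| "fv1 (And \<phi> \<psi>) = fv1 \<phi> \<union> fv1 \<psi>"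
| "fv1 (Forall x \<phi>) = fv1 \<phi> - {x}"
| "fv1 (Forall2 n X \<phi>) = fv1 \<phi>"

primrec fv2 :: "fm \<Rightarrow> (nat \<times> nat) set" where
  "fv2 (Mem x y) = {}"
| "fv2 (Eq x y) = {}"
| "fv2 (Rel X xs) = {(length xs, X)}"
| "fv2 (Neg \<phi>) = fv2 \<phi>"
| "fv2 (And \<phi> \<psi>) = fv2 \<phi> \<union> fv2 \<psi>"
| "fv2 (Forall x \<phi>) = fv2 \<phi>"
| "fv2 (Forall2 n X \<phi>) = fv2 \<phi> - {(n, X)}"

definition sentence :: "fm \<Rightarrow> bool" where
  "sentence \<phi> \<longleftrightarrow> fv1 \<phi> = {} \<and> fv2 \<phi> = {}"

definition relations :: "'m set \<Rightarrow> nat \<Rightarrow> 'm list set set" where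
  "relations M n = Pow {xs. length xs = n \<and> set xs \<subseteq> M}"

text \<open>Full semantics: relation variables range over all relations on the carrier \<open>M\<close>.\<close>

primrec sat :: "'m set \<Rightarrow> ('m \<Rightarrow> 'm \<Rightarrow> bool) \<Rightarrow> (nat \<Rightarrow> 'm) \<Rightarrow> (nat \<times> nat \<Rightarrow> 'm list set) \<Rightarrow> fm \<Rightarrow> bool"
where
  "sat M E s r (Mem x y) \<longleftrightarrow> E (s x) (s y)"
| "sat M E s r (Eq x y) \<longleftrightarrow> s x = s y"
| "sat M E s r (Rel X xs) \<longleftrightarrow> map s xs \<in> r (length xs, X)"
| "sat M E s r (Neg \<phi>) \<longleftrightarrow> \<not> sat M E s r \<phi>"
| "sat M E s r (And \<phi> \<psi>) \<longleftrightarrow> sat M E s r \<phi> \<and> sat M E s r \<psi>"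
| "sat M E s r (Forall x \<phi>) \<longleftrightarrow> (\<forall>a\<in>M. sat M E (s(x := a)) r \<phi>)"
| "sat M E s r (Forall2 n X \<phi>) \<longleftrightarrow> (\<forall>A\<in>relations M n. sat M E s (r((n, X) := A)) \<phi>)"

definition models :: "'m set \<Rightarrow> ('m \<Rightarrow> 'm \<Rightarrow> bool) \<Rightarrow> fm set \<Rightarrow> bool" where
  "models M E T \<longleftrightarrow> M \<noteq> {} \<and>
     (\<forall>\<phi>\<in>T. \<forall>s r. (\<forall>x. s x \<in> M) \<longrightarrow> (\<forall>n X. r (n, X) \<in> relations M n) \<longrightarrow> sat M E s r \<phi>)"

definition isomorphic ::
  "'m set \<Rightarrow> ('m \<Rightarrow> 'm \<Rightarrow> bool) \<Rightarrow> 'n set \<Rightarrow> ('n \<Rightarrow> 'n \<Rightarrow> bool) \<Rightarrow> bool" where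
  "isomorphic M E N F \<longleftrightarrow>
     (\<exists>f. bij_betw f M N \<and> (\<forall>x\<in>M. \<forall>y\<in>M. E x y \<longleftrightarrow> F (f x) (f y)))"


section \<open>Second-order ZFC\<close>

definition Extensionality :: fm where
  "Extensionality = Forall 0 (Forall 1 (Imp (Forall 2 (Iff (Mem 2 0) (Mem 2 1))) (Eq 0 1)))"

definition Foundation :: fm where
  "Foundation = Forall 0 (Imp (Exists 1 (Mem 1 0))
     (Exists 1 (And (Mem 1 0) (Neg (Exists 2 (And (Mem 2 1) (Mem 2 0)))))))"

definition Pairing :: fm where
  "Pairing = Forall 0 (Forall 1 (Exists 2 (Forall 3 (Iff (Mem 3 2) (Or (Eq 3 0) (Eq 3 1))))))"

definition Union_Axiom :: fm where
  "Union_Axiom = Forall 0 (Exists 1 (Forall 2 (Iff (Mem 2 1) (Exists 3 (And (Mem 3 0) (Mem 2 3))))))"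

definition Power_Set :: fm where
  "Power_Set = Forall 0 (Exists 1 (Forall 2 (Iff (Mem 2 1) (Forall 3 (Imp (Mem 3 2) (Mem 3 0))))))"

definition Infinity :: fm where
  "Infinity = Exists 0 (And
     (Exists 1 (And (Mem 1 0) (Forall 2 (Neg (Mem 2 1)))))
     (Forall 1 (Imp (Mem 1 0)
        (Exists 2 (And (Mem 2 0) (Forall 3 (Iff (Mem 3 2) (Or (Mem 3 1) (Eq 3 1)))))))))"

definition Separation2 :: fm where
  "Separation2 = Forall2 1 0 (Forall 0 (Exists 1 (Forall 2 (Iff (Mem 2 1) (And (Mem 2 0) (Rel 0 [2]))))))"

definition Replacement2 :: fm where
  "Replacement2 = Forall2 2 0 (Imp
     (Forall 0 (Forall 1 (Forall 2 (Imp (And (Rel 0 [0, 1]) (Rel 0 [0, 2])) (Eq 1 2)))))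
     (Forall 0 (Exists 1 (Forall 2 (Iff (Mem 2 1) (Exists 3 (And (Mem 3 0) (Rel 0 [3, 2]))))))))"

text \<open>Every set of nonempty pairwise disjoint sets has a transversal.\<close>

definition Choice :: fm where
  "Choice = Forall 0 (Imp
     (And
       (Forall 1 (Imp (Mem 1 0) (Exists 2 (Mem 2 1))))
       (Forall 1 (Forall 2 (Imp (And (Mem 1 0) (And (Mem 2 0) (Exists 3 (And (Mem 3 1) (Mem 3 2))))) (Eq 1 2)))))
     (Exists 1 (Forall 2 (Imp (Mem 2 0)
       (Exists 3 (Forall 4 (Iff (And (Mem 4 2) (Mem 4 1)) (Eq 4 3))))))))"

definition ZFC2 :: "fm set" where
  "ZFC2 = {Extensionality, Foundation, Pairing, Union_Axiom, Power_Set, Infinity,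
           Separation2, Replacement2, Choice}"

lemma ZFC2_sentences: "\<forall>\<sigma>\<in>ZFC2. sentence \<sigma>"
  by (auto simp: ZFC2_def sentence_def Extensionality_def Foundation_def Pairing_def
      Union_Axiom_def Power_Set_def Infinity_def Separation2_def Replacement2_def Choice_def)

text \<open>
  Inside the universe \<open>U\<close>, the theory ZFC2 + \<open>\<Sigma>\<close> has the rank-initial segment at \<open>\<kappa>\<close> as its
  unique model up to isomorphism. Here \<open>U\<close> is the whole universe or \<open>Vset \<theta>\<close> with \<open>\<theta>\<close> inaccessible.
  Such a \<open>U\<close> contains all relations on and all functions between its elements, so \<open>E\<close>, the
  isomorphism and the second-order quantifiers need no separate restriction to \<open>U\<close>.
\<close>

definition categorically_characterizes_in ::
  "'v::zfc_universe set \<Rightarrow> fm set \<Rightarrow> 'v \<Rightarrow> bool" where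
  "categorically_characterizes_in U \<Sigma> \<kappa> \<longleftrightarrow>
     (\<exists>v\<in>U. elts v = Vset \<kappa>) \<and> models (Vset \<kappa>) mem (ZFC2 \<union> \<Sigma>) \<and>
     (\<forall>m\<in>U. \<forall>E. models (elts m) E (ZFC2 \<union> \<Sigma>) \<longrightarrow> isomorphic (elts m) E (Vset \<kappa>) mem)"

end

theory Submission
  imports Defs
begin

text \<open>
  The core is Zermelo's quasi-categoricity theorem. In a set-sized model of ZFC2 the membership
  relation is well-founded, since the range of a descending sequence would be a set of the model by
  second-order replacement. Its Mostowski collapse is a transitive model, that is, a Grothendieck
  universe; a set-sized one is the rank-initial segment at its set of ordinals, which is
  inaccessible. Hence ZFC2 + \<open>\<Sigma>\<close> is categorical in a universe as soon as only one inaccessible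
  \<open>\<kappa>\<close> in it satisfies \<open>\<Sigma>\<close> at its rank-initial segment. If there are several such cardinals, take
  the least one as \<open>\<kappa>'\<close> and the second one as \<open>\<theta>\<close>.
\<close>


section \<open>Equipollence and infinite sets\<close>

lemma lesspoll_iff_not_lepoll: "A \<prec> B \<longleftrightarrow> \<not> B \<lesssim> A"
proof -
  have "A \<lesssim> B \<or> B \<lesssim> A"
    unfolding lepoll_def card_of_ordLeq by (rule ordLeq_total) (simp_all add: card_of_Well_order)
  then show ?thesis
    unfolding lesspoll_def by (blast intro: lepoll_antisym eqpoll_imp_lepoll eqpoll_sym)
qed

lemma lepoll_finite: "A \<lesssim> B \<Longrightarrow> finite B \<Longrightarrow> finite A"
  unfolding lepoll_iff by (blast intro: finite_surj)

lemma lepoll_UNION: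
  assumes "infinite B" "I \<lesssim> B" "\<And>i. i \<in> I \<Longrightarrow> A i \<lesssim> B"
  shows "(\<Union>i\<in>I. A i) \<lesssim> B"
  using assms unfolding lepoll_def card_of_ordLeq by (simp add: card_of_UNION_ordLeq_infinite)

lemma lepoll_Pow_mono:
  assumes "A \<lesssim> B"
  shows "Pow A \<lesssim> Pow B"
proof -
  obtain f where "inj_on f A" "f ` A \<subseteq> B"
    using assms unfolding lepoll_def by blast
  then have "inj_on ((`) f) (Pow A)" "(`) f ` Pow A \<subseteq> Pow B"
    by (auto intro: inj_on_image_Pow)
  then show ?thesis
    unfolding lepoll_def by blast
qed

lemma inductive_imp_infinite:
  assumes "e \<in> A"
    and succ: "\<And>y. y \<in> A \<Longrightarrow> \<exists>z\<in>A. \<forall>u\<in>A. E u z \<longleftrightarrow> E u y \<or> u = y"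
    and irrefl: "\<And>y. y \<in> A \<Longrightarrow> \<not> E y y"
  shows "infinite A"
proof
  assume "finite A"
  define preds where "preds y = {u \<in> A. E u y}" for y
  obtain y where "y \<in> A" and max: "Max ((\<lambda>y. card (preds y)) ` A) = card (preds y)"
    using obtains_MAX[OF \<open>finite A\<close>, of "\<lambda>y. card (preds y)"] \<open>e \<in> A\<close> by blast
  obtain z where "z \<in> A" "preds z = insert y (preds y)"
    using succ[OF \<open>y \<in> A\<close>] \<open>y \<in> A\<close> unfolding preds_def by blast
  moreover have "y \<notin> preds y" "finite (preds y)"
    using irrefl \<open>y \<in> A\<close> \<open>finite A\<close> by (auto simp: preds_def)
  moreover have "card (preds z) \<le> card (preds y)"
    unfolding max[symmetric] using \<open>finite A\<close> \<open>z \<in> A\<close> by simp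
  ultimately show False
    by simp
qed


section \<open>Sets among the classes\<close>

definition small_in :: "'v::zfc_universe set \<Rightarrow> 'v set \<Rightarrow> bool" where
  "small_in N A \<longleftrightarrow> (\<exists>x\<in>N. elts x = A)"

abbreviation small :: "'v::zfc_universe set \<Rightarrow> bool" where
  "small \<equiv> small_in UNIV"

text \<open>The value of \<open>set_of\<close> is unspecified on proper classes.\<close>

definition set_of :: "'v::zfc_universe set \<Rightarrow> 'v" where
  "set_of A = (THE x. elts x = A)"

lemma set_of_elts [simp]: "set_of (elts x) = x"
  unfolding set_of_def by (blast intro: extensionality_ax)

lemma elts_set_of [simp]: "small A \<Longrightarrow> elts (set_of A) = A"
  by (auto simp: small_in_def)

lemma small_in_imp_small: "small_in N A \<Longrightarrow> small A"
  by (auto simp: small_in_def)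

lemma small_in_imp_set_of_mem: "small_in N A \<Longrightarrow> set_of A \<in> N"
  by (auto simp: small_in_def)

lemma small_in_elts_iff [simp]: "small_in N (elts x) \<longleftrightarrow> x \<in> N"
  by (auto simp: small_in_def dest: extensionality_ax)

definition transitive_class :: "'v::zfc_universe set \<Rightarrow> bool" where
  "transitive_class N \<longleftrightarrow> (\<forall>x\<in>N. elts x \<subseteq> N)"

lemma transitive_classD: "\<lbrakk>transitive_class N; x \<in> N; mem y x\<rbrakk> \<Longrightarrow> y \<in> N"
  by (auto simp: transitive_class_def)


section \<open>Grothendieck universes\<close>

locale grothendieck_universe =
  fixes N :: "'v::zfc_universe set"
  assumes transitive: "transitive_class N"
    and power_closed: "x \<in> N \<Longrightarrow> small_in N {z. elts z \<subseteq> elts x}"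
    and UN_closed:
      "\<lbrakk>x \<in> N; \<And>y. mem y x \<Longrightarrow> small_in N (F y)\<rbrakk> \<Longrightarrow> small_in N (\<Union>y\<in>elts x. F y)"
    and infinite: "\<exists>x\<in>N. infinite (elts x)"
begin

lemmas mem_closed = transitive_classD[OF transitive]

lemma subset_closed:
  assumes "x \<in> N" "A \<subseteq> elts x"
  shows "small_in N A"
proof -
  obtain y where y: "elts y = A"
    using separation_ax[of x "\<lambda>z. z \<in> A"] assms(2) by (auto simp: Int_absorb1 Collect_conj_eq)
  obtain p where p: "p \<in> N" "elts p = {z. elts z \<subseteq> elts x}"
    using power_closed[OF assms(1)] by (auto simp: small_in_def)
  then have "y \<in> N"
    using mem_closed[of p y] y assms(2) by simp
  then show ?thesis
    using y by (auto simp: small_in_def)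
qed

lemma empty_closed: "small_in N {}"
  using infinite subset_closed by blast

lemma singleton_closed:
  assumes "x \<in> N"
  shows "small_in N {x}"
proof -
  obtain p where "p \<in> N" "elts p = {z. elts z \<subseteq> elts x}"
    using power_closed[OF assms] by (auto simp: small_in_def)
  then show ?thesis
    using subset_closed[of p "{x}"] by simp
qed

lemma UN_lepoll_closed:
  assumes "x \<in> N" "I \<lesssim> elts x" and F: "\<And>i. i \<in> I \<Longrightarrow> small_in N (F i)"
  shows "small_in N (\<Union>i\<in>I. F i)"
proof -
  obtain g where g: "I \<subseteq> g ` elts x"
    using assms(2) unfolding lepoll_iff by blast
  have "small_in N (\<Union>y\<in>elts x. if g y \<in> I then F (g y) else {})"
    using F empty_closed by (intro UN_closed[OF assms(1)]) simp
  moreover have "(\<Union>y\<in>elts x. if g y \<in> I then F (g y) else {}) = (\<Union>i\<in>I. F i)"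
    using g by (auto split: if_splits)
  ultimately show ?thesis by simp
qed

lemma lepoll_closed:
  assumes "x \<in> N" "A \<subseteq> N" "A \<lesssim> elts x"
  shows "small_in N A"
  using UN_lepoll_closed[OF assms(1,3), of "\<lambda>y. {y}"] singleton_closed assms(2) by auto

lemma countable_closed:
  assumes "countable A" "A \<subseteq> N"
  shows "small_in N A"
proof -
  obtain x where "x \<in> N" "infinite (elts x)"
    using infinite by blast
  moreover have "A \<lesssim> (UNIV :: nat set)"
    using assms(1) unfolding countable_def lepoll_def by blast
  ultimately show ?thesis
    using lepoll_closed assms(2) lepoll_trans infinite_le_lepoll by metis
qed

lemma Un_closed:
  assumes "small_in N A" "small_in N B"
  shows "small_in N (A \<union> B)"
proof -
  obtain x where x: "x \<in> N" "infinite (elts x)"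
    using infinite by blast
  have "(UNIV :: bool set) \<lesssim> elts x"
    using x(2) by (intro finite_lepoll_infinite) simp_all
  then show ?thesis
    unfolding Un_eq_UN using assms by (intro UN_lepoll_closed[OF x(1)]) simp_all
qed

lemma insert_closed: "x \<in> N \<Longrightarrow> small_in N A \<Longrightarrow> small_in N (insert x A)"
  using Un_closed[OF singleton_closed, of x A] by simp

end

lemma infinite_set_exists: "\<exists>x::'v::zfc_universe. infinite (elts x)"
proof -
  obtain w e :: 'v where "mem e w"
    and succ: "\<forall>y\<in>elts w. \<exists>z\<in>elts w. elts z = insert y (elts y)"
    using infinity_ax by blast
  have irrefl: "\<not> mem y y" for y :: 'v
  proof -
    obtain z where "elts z = {y}"
      using pairing_ax[of y y] by auto
    then show ?thesis
      using foundation_ax[of z] by auto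
  qed
  have "\<exists>z\<in>elts w. \<forall>u\<in>elts w. mem u z \<longleftrightarrow> mem u y \<or> u = y" if "mem y w" for y
    using succ that by (metis insert_iff)
  with \<open>mem e w\<close> irrefl have "infinite (elts w)"
    by (intro inductive_imp_infinite[of e _ mem])
  then show ?thesis ..
qed

text \<open>
  The closure lemmas at \<open>UNIV\<close> are the set existence principles of the background universe.
\<close>

interpretation universe: grothendieck_universe "UNIV :: 'v::zfc_universe set"
proof
  show "transitive_class (UNIV :: 'v set)"
    by (simp add: transitive_class_def)
  show "small {z. elts z \<subseteq> elts x}" for x :: 'v
    using power_ax[of x] by (auto simp: small_in_def)
  show "small (\<Union>y\<in>elts x. F y)" if F: "\<And>y. mem y x \<Longrightarrow> small (F y)" for x and F :: "'v \<Rightarrow> 'v set"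
  proof -
    obtain b where "elts b = (\<lambda>y. set_of (F y)) ` elts x"
      using replacement_ax[of "\<lambda>y. set_of (F y)" x] by blast
    then show ?thesis
      using union_ax[of b] F by (simp add: small_in_def[of UNIV "\<Union>y\<in>elts x. F y"])
  qed
  show "\<exists>x\<in>(UNIV :: 'v set). infinite (elts x)"
    using infinite_set_exists by blast
qed

definition succ :: "'v::zfc_universe \<Rightarrow> 'v" where
  "succ x = set_of (insert x (elts x))"

lemma elts_succ [simp]: "elts (succ x) = insert x (elts x)"
  by (simp add: succ_def universe.insert_closed)

lemma (in grothendieck_universe) succ_closed: "x \<in> N \<Longrightarrow> succ x \<in> N"
  using insert_closed[of x "elts x"] by (simp add: succ_def small_in_imp_set_of_mem)


section \<open>Models of second-order ZFC\<close>

locale zfc2_structure =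
  fixes M :: "'m set" and E :: "'m \<Rightarrow> 'm \<Rightarrow> bool"
  assumes nonempty: "M \<noteq> {}"
    and extensionality: "\<forall>x\<in>M. \<forall>y\<in>M. (\<forall>z\<in>M. E z x \<longleftrightarrow> E z y) \<longrightarrow> x = y"
    and foundation: "\<forall>x\<in>M. (\<exists>y\<in>M. E y x) \<longrightarrow> (\<exists>y\<in>M. E y x \<and> (\<forall>z\<in>M. \<not> (E z y \<and> E z x)))"
    and pairing: "\<forall>x\<in>M. \<forall>y\<in>M. \<exists>z\<in>M. \<forall>u\<in>M. E u z \<longleftrightarrow> u = x \<or> u = y"
    and union: "\<forall>x\<in>M. \<exists>u\<in>M. \<forall>z\<in>M. E z u \<longleftrightarrow> (\<exists>y\<in>M. E y x \<and> E z y)"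
    and power: "\<forall>x\<in>M. \<exists>p\<in>M. \<forall>z\<in>M. E z p \<longleftrightarrow> (\<forall>y\<in>M. E y z \<longrightarrow> E y x)"
    and infinity: "\<exists>w\<in>M. (\<exists>e\<in>M. E e w \<and> (\<forall>z\<in>M. \<not> E z e)) \<and>
      (\<forall>y\<in>M. E y w \<longrightarrow> (\<exists>z\<in>M. E z w \<and> (\<forall>u\<in>M. E u z \<longleftrightarrow> E u y \<or> u = y)))"
    and separation: "\<forall>P. \<forall>x\<in>M. \<exists>b\<in>M. \<forall>z\<in>M. E z b \<longleftrightarrow> E z x \<and> P z"
    and replacement: "\<forall>Q. (\<forall>x\<in>M. \<forall>y\<in>M. \<forall>z\<in>M. Q x y \<and> Q x z \<longrightarrow> y = z) \<longrightarrow>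
      (\<forall>x\<in>M. \<exists>b\<in>M. \<forall>z\<in>M. E z b \<longleftrightarrow> (\<exists>y\<in>M. E y x \<and> Q y z))"
    and choice: "\<forall>x\<in>M.
      (\<forall>y\<in>M. E y x \<longrightarrow> (\<exists>z\<in>M. E z y)) \<and>
      (\<forall>y\<in>M. \<forall>z\<in>M. E y x \<and> E z x \<and> (\<exists>u\<in>M. E u y \<and> E u z) \<longrightarrow> y = z) \<longrightarrow>
      (\<exists>t\<in>M. \<forall>y\<in>M. E y x \<longrightarrow> (\<exists>z\<in>M. \<forall>u\<in>M. E u y \<and> E u t \<longleftrightarrow> u = z))"

lemma ball_relations_1:
  "(\<forall>A\<in>relations M 1. \<Phi> A) \<longleftrightarrow> (\<forall>P. \<Phi> {[x] |x. x \<in> M \<and> P x})"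
proof safe
  fix P assume "\<forall>A\<in>relations M 1. \<Phi> A"
  then show "\<Phi> {[x] |x. x \<in> M \<and> P x}"
    by (rule bspec) (auto simp: relations_def)
next
  fix A assume \<Phi>: "\<forall>P. \<Phi> {[x] |x. x \<in> M \<and> P x}" and "A \<in> relations M 1"
  then have "A = {[x] |x. x \<in> M \<and> [x] \<in> A}"
    by (auto simp: relations_def length_Suc_conv)
  then show "\<Phi> A"
    using \<Phi>[rule_format, of "\<lambda>x. [x] \<in> A"] by simp
qed

lemma ball_relations_2:
  "(\<forall>A\<in>relations M 2. \<Phi> A) \<longleftrightarrow> (\<forall>Q. \<Phi> {[x, y] |x y. x \<in> M \<and> y \<in> M \<and> Q x y})"
proof safe
  fix Q assume "\<forall>A\<in>relations M 2. \<Phi> A"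
  then show "\<Phi> {[x, y] |x y. x \<in> M \<and> y \<in> M \<and> Q x y}"
    by (rule bspec) (auto simp: relations_def)
next
  fix A assume \<Phi>: "\<forall>Q. \<Phi> {[x, y] |x y. x \<in> M \<and> y \<in> M \<and> Q x y}" and "A \<in> relations M 2"
  then have "A = {[x, y] |x y. x \<in> M \<and> y \<in> M \<and> [x, y] \<in> A}"
    by (auto simp: relations_def length_Suc_conv numeral_2_eq_2)
  then show "\<Phi> A"
    using \<Phi>[rule_format, of "\<lambda>x y. [x, y] \<in> A"] by simp
qed

lemma derived_connectives:
  "\<not> (P \<and> \<not> Q) \<longleftrightarrow> (P \<longrightarrow> Q)" "(\<not> P \<longrightarrow> Q) \<longleftrightarrow> P \<or> Q"
  "(P \<longrightarrow> Q) \<and> (Q \<longrightarrow> P) \<longleftrightarrow> (P \<longleftrightarrow> Q)"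
  "\<not> (\<forall>x\<in>M. \<not> R x) \<longleftrightarrow> (\<exists>x\<in>M. R x)"
  by blast+

lemmas sat_eval = derived_connectives sat.simps fun_upd_apply rel_simps if_True if_False simp_thms

lemmas ZFC2_axiom_defs = Extensionality_def Pairing_def Union_Axiom_def
  Power_Set_def Infinity_def Choice_def

lemma sat_Foundation:
  "sat M E s r Foundation \<longleftrightarrow>
    (\<forall>x\<in>M. (\<exists>y\<in>M. E y x) \<longrightarrow> (\<exists>y\<in>M. E y x \<and> (\<forall>z\<in>M. \<not> (E z y \<and> E z x))))"
  unfolding Foundation_def by (simp only: sat_eval) blast

lemma sat_Separation2:
  "sat M E s r Separation2 \<longleftrightarrow>
    (\<forall>P. \<forall>x\<in>M. \<exists>b\<in>M. \<forall>z\<in>M. E z b \<longleftrightarrow> E z x \<and> P z)"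
  unfolding Separation2_def sat.simps(7) ball_relations_1
  by (simp only: sat_eval list.map list.size One_nat_def numeral_2_eq_2 add_0 add_0_right
      add_Suc_right nat.inject nat.distinct mem_Collect_eq list.inject ex_simps
      cong: ball_cong bex_cong)

lemma sat_Replacement2:
  "sat M E s r Replacement2 \<longleftrightarrow>
    (\<forall>Q. (\<forall>x\<in>M. \<forall>y\<in>M. \<forall>z\<in>M. Q x y \<and> Q x z \<longrightarrow> y = z) \<longrightarrow>
      (\<forall>x\<in>M. \<exists>b\<in>M. \<forall>z\<in>M. E z b \<longleftrightarrow> (\<exists>y\<in>M. E y x \<and> Q y z)))"
proof -
  have ex_pair_eq: "(\<exists>x y. (a = x \<and> b = y) \<and> R x y) \<longleftrightarrow> R a b" for a b :: 'a and R
    by blast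
  show ?thesis
    unfolding Replacement2_def sat.simps(7) ball_relations_2
    by (simp only: sat_eval list.map list.size One_nat_def numeral_2_eq_2 numeral_3_eq_3 add_0
      add_0_right add_Suc_right nat.inject nat.distinct mem_Collect_eq list.inject ex_pair_eq
      cong: ball_cong bex_cong)
qed

lemma sat_ZFC2_iff:
  assumes "M \<noteq> {}"
  shows "(\<forall>\<phi>\<in>ZFC2. sat M E s r \<phi>) \<longleftrightarrow> zfc2_structure M E"
  using assms unfolding ZFC2_def zfc2_structure_def ball_simps(5,7) conj_assoc
  by (simp only: sat_Foundation sat_Separation2 sat_Replacement2 ZFC2_axiom_defs sat_eval)

lemma models_ZFC2_iff: "models M E ZFC2 \<longleftrightarrow> zfc2_structure M E"
proof (cases "M = {}")
  case True
  then show ?thesis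
    by (simp add: models_def zfc2_structure_def)
next
  case False
  then obtain a where "a \<in> M"
    by blast
  then have "\<exists>s r. (\<forall>x. s x \<in> M) \<and> (\<forall>n X. r (n :: nat, X :: nat) \<in> relations M n)"
    by (intro exI[of _ "\<lambda>_. a"] exI[of _ "\<lambda>_. {}"]) (simp add: relations_def)
  then show ?thesis
    unfolding models_def using False sat_ZFC2_iff[OF False, of E] by blast
qed

context zfc2_structure
begin

definition extent :: "'m \<Rightarrow> 'm set" where
  "extent x = {y \<in> M. E y x}"

definition mem_rel :: "('m \<times> 'm) set" where
  "mem_rel = {(y, x). y \<in> M \<and> x \<in> M \<and> E y x}"

lemma irrefl:
  assumes "x \<in> M"
  shows "\<not> E x x"
proof -
  obtain z where "z \<in> M" "\<forall>u\<in>M. E u z \<longleftrightarrow> u = x"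
    using pairing[rule_format, OF assms assms] by auto
  then show ?thesis
    using foundation[rule_format, of z] assms by auto
qed

lemma infinite_extent: "\<exists>w\<in>M. infinite (extent w)"
proof -
  obtain w where "w \<in> M" and empty: "\<exists>e\<in>M. E e w \<and> (\<forall>z\<in>M. \<not> E z e)"
    and succ: "\<forall>y\<in>M. E y w \<longrightarrow> (\<exists>z\<in>M. E z w \<and> (\<forall>u\<in>M. E u z \<longleftrightarrow> E u y \<or> u = y))"
    by (rule bexE[OF infinity]) blast
  obtain e where "e \<in> extent w"
    using empty unfolding extent_def by blast
  have "\<exists>z\<in>extent w. \<forall>u\<in>extent w. E u z \<longleftrightarrow> E u y \<or> u = y" if y: "y \<in> extent w" for y
  proof -
    obtain z where "z \<in> M" "E z w" "\<forall>u\<in>M. E u z \<longleftrightarrow> E u y \<or> u = y"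
      using succ y by (auto simp: extent_def)
    then show ?thesis
      by (intro bexI[of _ z]) (simp_all add: extent_def)
  qed
  with \<open>e \<in> extent w\<close> have "infinite (extent w)"
    by (rule inductive_imp_infinite) (auto simp: extent_def dest: irrefl)
  with \<open>w \<in> M\<close> show ?thesis ..
qed

lemma ex_extent_eq_if_lepoll:
  assumes "x \<in> M" "A \<subseteq> M" "A \<lesssim> extent x"
  shows "\<exists>b\<in>M. extent b = A"
proof -
  obtain g where g: "A \<subseteq> g ` extent x"
    using assms(3) unfolding lepoll_iff by blast
  obtain b where "b \<in> M" "\<forall>z\<in>M. E z b \<longleftrightarrow> (\<exists>y\<in>M. E y x \<and> z = g y \<and> z \<in> A)"
    using replacement[rule_format, of "\<lambda>y z. z = g y \<and> z \<in> A" x] assms(1) by auto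
  then have "extent b = A"
    using g assms(2) unfolding extent_def by blast
  with \<open>b \<in> M\<close> show ?thesis ..
qed

lemma wf_mem_rel: "wf mem_rel"
  unfolding wf_iff_no_infinite_down_chain
proof
  assume "\<exists>a. \<forall>i. (a (Suc i), a i) \<in> mem_rel"
  then obtain a where a: "\<And>i::nat. a i \<in> M" "\<And>i. E (a (Suc i)) (a i)"
    by (auto simp: mem_rel_def)
  obtain w where "w \<in> M" "infinite (extent w)"
    using infinite_extent by blast
  moreover from this have "range a \<lesssim> extent w"
    by (meson image_lepoll infinite_le_lepoll lepoll_trans)
  ultimately obtain b where b: "b \<in> M" "extent b = range a"
    using ex_extent_eq_if_lepoll[of w "range a"] a(1) by blast
  then have mem_b: "E y b \<longleftrightarrow> y \<in> range a" if "y \<in> M" for y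
    using that by (auto simp: extent_def)
  then obtain i where "\<forall>z\<in>M. \<not> (E z (a i) \<and> E z b)"
    using foundation[rule_format, OF b(1)] a(1) by (metis rangeE)
  then show False
    using a mem_b by blast
qed

end


section \<open>Grothendieck universes as models\<close>

lemma ex_comprehension_iff:
  assumes "transitive_class N"
  shows "(\<exists>b\<in>N. \<forall>z\<in>N. mem z b \<longleftrightarrow> P z) \<longleftrightarrow> small_in N {z \<in> N. P z}"
  using transitive_classD[OF assms] unfolding small_in_def by blast

lemma bounded_quantifier_iff:
  assumes "transitive_class N" "x \<in> N"
  shows "(\<exists>y\<in>N. mem y x \<and> P y) \<longleftrightarrow> (\<exists>y\<in>elts x. P y)"
    and "(\<forall>y\<in>N. mem y x \<longrightarrow> P y) \<longleftrightarrow> (\<forall>y\<in>elts x. P y)"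
  using transitive_classD[OF assms] by blast+

context grothendieck_universe
begin

lemma transversal_exists:
  assumes "x \<in> N" and nonempty: "\<And>y. mem y x \<Longrightarrow> elts y \<noteq> {}"
    and disjoint: "\<And>y z u. \<lbrakk>mem y x; mem z x; mem u y; mem u z\<rbrakk> \<Longrightarrow> y = z"
  shows "\<exists>t\<in>N. \<forall>y\<in>elts x. \<exists>z. elts y \<inter> elts t = {z}"
proof -
  define c where "c y = (SOME z. mem z y)" for y :: 'v
  have c: "mem (c y) y" if "mem y x" for y
    using nonempty[OF that] by (simp add: c_def some_in_eq)
  then have "c ` elts x \<subseteq> N"
    using mem_closed assms(1) by blast
  then have "small_in N (c ` elts x)"
    using lepoll_closed assms(1) image_lepoll by blast
  then obtain t where "t \<in> N" "elts t = c ` elts x"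
    unfolding small_in_def by blast
  moreover have "elts y \<inter> c ` elts x = {c y}" if "mem y x" for y
    using c disjoint that by blast
  ultimately show ?thesis
    by metis
qed

lemmas relativize = ex_comprehension_iff[OF transitive] bounded_quantifier_iff[OF transitive]

lemma extensionality_holds: "\<forall>x\<in>N. \<forall>y\<in>N. (\<forall>z\<in>N. mem z x \<longleftrightarrow> mem z y) \<longrightarrow> x = y"
  using mem_closed by (auto intro!: extensionality_ax)

lemma foundation_holds:
  "\<forall>x\<in>N. (\<exists>y\<in>N. mem y x) \<longrightarrow> (\<exists>y\<in>N. mem y x \<and> (\<forall>z\<in>N. \<not> (mem z y \<and> mem z x)))"
proof (intro ballI impI)
  fix x assume "x \<in> N" "\<exists>y\<in>N. mem y x"
  then obtain y where "mem y x" "elts y \<inter> elts x = {}"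
    using foundation_ax[of x] by blast
  then show "\<exists>y\<in>N. mem y x \<and> (\<forall>z\<in>N. \<not> (mem z y \<and> mem z x))"
    using mem_closed \<open>x \<in> N\<close> by blast
qed

lemma pairing_holds: "\<forall>x\<in>N. \<forall>y\<in>N. \<exists>z\<in>N. \<forall>u\<in>N. mem u z \<longleftrightarrow> u = x \<or> u = y"
  unfolding relativize
proof (intro ballI countable_closed)
  show "countable {u \<in> N. u = x \<or> u = y}" for x y
    by (rule countable_subset[of _ "{x, y}"]) auto
qed simp

lemma union_holds: "\<forall>x\<in>N. \<exists>u\<in>N. \<forall>z\<in>N. mem z u \<longleftrightarrow> (\<exists>y\<in>N. mem y x \<and> mem z y)"
proof -
  have "{z \<in> N. \<exists>y\<in>elts x. mem z y} = (\<Union>y\<in>elts x. elts y)" if "x \<in> N" for x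
    using mem_closed that by blast
  then show ?thesis
    using mem_closed by (simp add: relativize UN_closed)
qed

lemma power_holds: "\<forall>x\<in>N. \<exists>p\<in>N. \<forall>z\<in>N. mem z p \<longleftrightarrow> (\<forall>y\<in>N. mem y z \<longrightarrow> mem y x)"
proof -
  have "{z \<in> N. \<forall>y\<in>elts z. mem y x} = {z. elts z \<subseteq> elts x}" if "x \<in> N" for x
    using subset_closed[OF that, of "elts _"] by auto
  then show ?thesis
    by (simp add: relativize power_closed cong: conj_cong)
qed

lemma infinity_holds:
  "\<exists>w\<in>N. (\<exists>e\<in>N. mem e w \<and> (\<forall>z\<in>N. \<not> mem z e)) \<and>
    (\<forall>y\<in>N. mem y w \<longrightarrow> (\<exists>z\<in>N. mem z w \<and> (\<forall>u\<in>N. mem u z \<longleftrightarrow> mem u y \<or> u = y)))"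
proof -
  define a where "a n = (succ ^^ n) (set_of {} :: 'v)" for n
  have a_closed: "a n \<in> N" for n
    by (induction n) (simp_all add: a_def succ_closed empty_closed small_in_imp_set_of_mem)
  then obtain w where "w \<in> N" and w: "elts w = range a"
    using countable_closed[of "range a"] by (auto simp: small_in_def)
  have "elts (a 0) = {}"
    by (simp add: a_def universe.empty_closed)
  then have "\<exists>e\<in>N. mem e w \<and> (\<forall>z\<in>N. \<not> mem z e)"
    using a_closed w by (intro bexI[of _ "a 0"]) auto
  moreover have "elts (a (Suc n)) = insert (a n) (elts (a n))" for n
    by (simp add: a_def)
  then have "\<exists>z\<in>N. mem z w \<and> (\<forall>u\<in>N. mem u z \<longleftrightarrow> mem u (a n) \<or> u = a n)" for n
    using a_closed w by (intro bexI[of _ "a (Suc n)"]) auto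
  ultimately show ?thesis
    by (intro bexI[OF _ \<open>w \<in> N\<close>]) (auto simp: w)
qed

lemma separation_holds: "\<forall>P. \<forall>x\<in>N. \<exists>b\<in>N. \<forall>z\<in>N. mem z b \<longleftrightarrow> mem z x \<and> P z"
  unfolding relativize
proof (intro allI ballI)
  show "small_in N {z \<in> N. mem z x \<and> P z}" if "x \<in> N" for P x
    by (rule subset_closed[OF that]) auto
qed

lemma replacement_holds:
  "\<forall>Q. (\<forall>x\<in>N. \<forall>y\<in>N. \<forall>z\<in>N. Q x y \<and> Q x z \<longrightarrow> y = z) \<longrightarrow>
    (\<forall>x\<in>N. \<exists>b\<in>N. \<forall>z\<in>N. mem z b \<longleftrightarrow> (\<exists>y\<in>N. mem y x \<and> Q y z))"
proof (intro allI impI ballI)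
  fix Q x assume Q: "\<forall>x\<in>N. \<forall>y\<in>N. \<forall>z\<in>N. Q x y \<and> Q x z \<longrightarrow> y = z" and "x \<in> N"
  have "{z \<in> N. \<exists>y\<in>elts x. Q y z} \<lesssim> elts x"
    by (rule lepoll_relational_full[where R = Q]) (use Q mem_closed \<open>x \<in> N\<close> in auto)
  then have "small_in N {z \<in> N. \<exists>y\<in>elts x. Q y z}"
    by (intro lepoll_closed[OF \<open>x \<in> N\<close>]) simp_all
  with \<open>x \<in> N\<close> show "\<exists>b\<in>N. \<forall>z\<in>N. mem z b \<longleftrightarrow> (\<exists>y\<in>N. mem y x \<and> Q y z)"
    by (simp add: relativize)
qed

lemma choice_holds:
  "\<forall>x\<in>N. (\<forall>y\<in>N. mem y x \<longrightarrow> (\<exists>z\<in>N. mem z y)) \<and>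
    (\<forall>y\<in>N. \<forall>z\<in>N. mem y x \<and> mem z x \<and> (\<exists>u\<in>N. mem u y \<and> mem u z) \<longrightarrow> y = z) \<longrightarrow>
    (\<exists>t\<in>N. \<forall>y\<in>N. mem y x \<longrightarrow> (\<exists>z\<in>N. \<forall>u\<in>N. mem u y \<and> mem u t \<longleftrightarrow> u = z))"
proof (intro ballI impI, elim conjE)
  fix x assume "x \<in> N" and nonempty: "\<forall>y\<in>N. mem y x \<longrightarrow> (\<exists>z\<in>N. mem z y)"
    and disjoint: "\<forall>y\<in>N. \<forall>z\<in>N. mem y x \<and> mem z x \<and> (\<exists>u\<in>N. mem u y \<and> mem u z) \<longrightarrow> y = z"
  have "elts y \<noteq> {}" if "mem y x" for y
    using nonempty mem_closed[OF \<open>x \<in> N\<close> that] that by auto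
  moreover have "y = z" if "mem y x" "mem z x" "mem u y" "mem u z" for y z u
    using disjoint[rule_format, of y z] mem_closed \<open>x \<in> N\<close> that by blast
  ultimately have "\<exists>t\<in>N. \<forall>y\<in>elts x. \<exists>z. elts y \<inter> elts t = {z}"
    by (rule transversal_exists[OF \<open>x \<in> N\<close>])
  then obtain t where "t \<in> N" and t: "\<forall>y\<in>elts x. \<exists>z. elts y \<inter> elts t = {z}"
    by (rule bexE)
  have "\<exists>z\<in>N. \<forall>u\<in>N. mem u y \<and> mem u t \<longleftrightarrow> u = z" if y: "mem y x" for y
  proof -
    obtain z where "elts y \<inter> elts t = {z}"
      using t y by blast
    then show ?thesis
      using mem_closed[OF \<open>t \<in> N\<close>] by (intro bexI[of _ z]) auto
  qed
  with \<open>t \<in> N\<close> show "\<exists>t\<in>N. \<forall>y\<in>N. mem y x \<longrightarrow> (\<exists>z\<in>N. \<forall>u\<in>N. mem u y \<and> mem u t \<longleftrightarrow> u = z)"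
    by blast
qed

lemma zfc2_structure: "zfc2_structure N mem"
proof
  show "N \<noteq> {}"
    using infinite by blast
qed (fact extensionality_holds foundation_holds pairing_holds union_holds power_holds infinity_holds
    separation_holds replacement_holds choice_holds)+

end

locale transitive_zfc2_structure = zfc2_structure N mem for N :: "'v::zfc_universe set" +
  assumes transitive: "transitive_class N"
begin

lemmas mem_closed = transitive_classD[OF transitive]

lemmas relativize = ex_comprehension_iff[OF transitive] bounded_quantifier_iff[OF transitive]

lemma subset_mem:
  assumes "x \<in> N" "elts z \<subseteq> elts x"
  shows "z \<in> N"
proof -
  have "small_in N {u \<in> N. mem u x \<and> mem u z}"
    using separation[unfolded relativize, rule_format, of x "\<lambda>u. mem u z"] assms(1) by simp
  moreover have "{u \<in> N. mem u x \<and> mem u z} = elts z"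
    using mem_closed assms by blast
  ultimately show ?thesis by simp
qed

lemma power_small_in:
  assumes "x \<in> N"
  shows "small_in N {z. elts z \<subseteq> elts x}"
proof -
  have "small_in N {z \<in> N. \<forall>y\<in>elts z. mem y x}"
    using power assms by (simp add: relativize cong: conj_cong)
  moreover have "{z \<in> N. \<forall>y\<in>elts z. mem y x} = {z. elts z \<subseteq> elts x}"
    using subset_mem[OF assms] by blast
  ultimately show ?thesis by simp
qed

lemma UN_small_in:
  assumes "x \<in> N" and F: "\<And>y. mem y x \<Longrightarrow> small_in N (F y)"
  shows "small_in N (\<Union>y\<in>elts x. F y)"
proof -
  have f: "set_of (F y) \<in> N" "elts (set_of (F y)) = F y" if "mem y x" for y
    using F[OF that] by (auto simp: small_in_imp_set_of_mem small_in_imp_small)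
  have "small_in N {z \<in> N. \<exists>y\<in>elts x. z = set_of (F y)}"
    using replacement[rule_format, of "\<lambda>y z. z = set_of (F y)" x] assms(1)
    by (simp add: relativize)
  moreover have "{z \<in> N. \<exists>y\<in>elts x. z = set_of (F y)} = (\<lambda>y. set_of (F y)) ` elts x"
    using f(1) by blast
  ultimately obtain b where b: "b \<in> N" "elts b = (\<lambda>y. set_of (F y)) ` elts x"
    by (auto simp: small_in_def)
  have "small_in N {z \<in> N. \<exists>v\<in>elts b. mem z v}"
    using union[rule_format, OF b(1)] b(1) by (simp only: relativize)
  moreover have "{z \<in> N. \<exists>v\<in>elts b. mem z v} = (\<Union>v\<in>elts b. elts v)"
    using mem_closed b(1) by blast
  ultimately show ?thesis
    by (simp add: b(2) f(2))
qed

lemma grothendieck_universe: "grothendieck_universe N"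
proof
  obtain w where "w \<in> N" "infinite (extent w)"
    using infinite_extent by blast
  moreover have "extent w \<subseteq> elts w"
    by (auto simp: extent_def)
  ultimately show "\<exists>x\<in>N. infinite (elts x)"
    using infinite_super by blast
qed (fact transitive power_small_in UN_small_in)+

end

theorem transitive_models_ZFC2_iff:
  assumes "transitive_class N"
  shows "models N mem ZFC2 \<longleftrightarrow> grothendieck_universe N"
  using assms unfolding models_ZFC2_iff
  by (blast intro: grothendieck_universe.zfc2_structure
      transitive_zfc2_structure.grothendieck_universe
      transitive_zfc2_structure.intro transitive_zfc2_structure_axioms.intro)


section \<open>Membership induction and the Mostowski collapse\<close>

lemma wf_mem: "wf {(y, x :: 'v::zfc_universe). mem y x}"
proof -
  interpret zfc2_structure "UNIV :: 'v set" mem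
    by (rule universe.zfc2_structure)
  show ?thesis
    using wf_mem_rel by (simp add: mem_rel_def)
qed

lemma mem_induct [case_names step]:
  assumes "\<And>x :: 'v::zfc_universe. (\<And>y. mem y x \<Longrightarrow> P y) \<Longrightarrow> P x"
  shows "P a"
  using wf_induct[OF wf_mem, of P a] assms by auto

lemma not_mem_self: "\<not> mem x (x :: 'v::zfc_universe)"
  using wf_not_refl[OF wf_mem] by auto

definition collapse :: "('a \<times> 'a) set \<Rightarrow> 'a \<Rightarrow> 'v::zfc_universe" where
  "collapse R = wfrec R (\<lambda>c x. set_of (c ` {y. (y, x) \<in> R}))"

context
  fixes R :: "('a \<times> 'a) set" and A and v :: "'v::zfc_universe"
  assumes wf: "wf R" and field: "R \<subseteq> A \<times> A" and set_sized: "A \<lesssim> elts v"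
begin

lemma small_collapse_image:
  assumes "B \<subseteq> A"
  shows "small (collapse R ` B :: 'v set)"
  using lepoll_trans[OF image_lepoll lepoll_trans[OF subset_imp_lepoll[OF assms] set_sized]]
  by (rule universe.lepoll_closed[OF UNIV_I subset_UNIV])

lemma elts_collapse: "elts (collapse R x :: 'v) = collapse R ` {y. (y, x) \<in> R}"
proof -
  have "(collapse R x :: 'v) = set_of (cut (collapse R) R x ` {y. (y, x) \<in> R})"
    unfolding collapse_def by (subst wfrec[OF wf]) (rule refl)
  also have "cut (collapse R) R x ` {y. (y, x) \<in> R} = (collapse R ` {y. (y, x) \<in> R} :: 'v set)"
    by (intro image_cong) (auto simp: cut_apply)
  finally have "(collapse R x :: 'v) = set_of (collapse R ` {y. (y, x) \<in> R})" .
  moreover have "small (collapse R ` {y. (y, x) \<in> R} :: 'v set)"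
    by (rule small_collapse_image) (use field in blast)
  ultimately show ?thesis
    by simp
qed

lemma inj_on_collapse:
  assumes extensional: "\<And>x y. \<lbrakk>x \<in> A; y \<in> A; \<And>z. (z, x) \<in> R \<longleftrightarrow> (z, y) \<in> R\<rbrakk> \<Longrightarrow> x = y"
  shows "inj_on (collapse R :: 'a \<Rightarrow> 'v) A"
proof -
  let ?c = "collapse R :: 'a \<Rightarrow> 'v"
  have "x \<in> A \<Longrightarrow> \<forall>y\<in>A. ?c x = ?c y \<longrightarrow> x = y" for x
    using wf
  proof (induction x rule: wf_induct_rule)
    case (less x)
    show ?case
    proof (intro ballI impI)
      fix y assume "y \<in> A" "?c x = ?c y"
      then have images_eq: "?c ` {z. (z, x) \<in> R} = ?c ` {z. (z, y) \<in> R}"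
        using elts_collapse by metis
      have inj: "z = u" if "(z, x) \<in> R" "(u, y) \<in> R" "?c z = ?c u" for z u
        using less.IH[OF that(1)] field that by blast
      have "(z, x) \<in> R \<longleftrightarrow> (z, y) \<in> R" for z
      proof
        assume "(z, x) \<in> R"
        then have "?c z \<in> ?c ` {z. (z, y) \<in> R}"
          unfolding images_eq[symmetric] by blast
        then obtain u where "(u, y) \<in> R" "?c z = ?c u"
          by blast
        with inj[OF \<open>(z, x) \<in> R\<close>, of u] show "(z, y) \<in> R" by simp
      next
        assume "(z, y) \<in> R"
        then have "?c z \<in> ?c ` {z. (z, x) \<in> R}"
          unfolding images_eq by blast
        then obtain u where "(u, x) \<in> R" "?c z = ?c u"
          by blast
        with inj[OF _ \<open>(z, y) \<in> R\<close>, of u] show "(z, x) \<in> R" by simp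
      qed
      then show "x = y"
        using extensional less.prems \<open>y \<in> A\<close> by blast
    qed
  qed
  then show ?thesis
    by (auto simp: inj_on_def)
qed

theorem mostowski_collapse:
  assumes "\<And>x y. \<lbrakk>x \<in> A; y \<in> A; \<And>z. (z, x) \<in> R \<longleftrightarrow> (z, y) \<in> R\<rbrakk> \<Longrightarrow> x = y"
  shows "\<exists>N :: 'v set. small N \<and> transitive_class N \<and> isomorphic A (\<lambda>x y. (x, y) \<in> R) N mem"
proof (intro exI conjI)
  let ?c = "collapse R :: 'a \<Rightarrow> 'v"
  show "small (?c ` A)"
    by (rule small_collapse_image) simp
  show "transitive_class (?c ` A)"
    using field by (auto simp: transitive_class_def elts_collapse)
  have inj: "inj_on ?c A"
    using assms by (rule inj_on_collapse)
  then have "?c x \<in> ?c ` {z. (z, y) \<in> R} \<longleftrightarrow> (x, y) \<in> R" if "x \<in> A" for x y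
    using inj_on_image_mem_iff[OF inj that, of "{z. (z, y) \<in> R}"] field by auto
  then show "isomorphic A (\<lambda>x y. (x, y) \<in> R) (?c ` A) mem"
    unfolding isomorphic_def using inj
    by (intro exI[of _ ?c]) (simp add: bij_betw_def elts_collapse)
qed

end


section \<open>Ordinals\<close>

lemma ordinal_mem: "ordinal \<alpha> \<Longrightarrow> mem \<beta> \<alpha> \<Longrightarrow> ordinal \<beta>"
  unfolding ordinal_def transitive_set_def by blast

lemma ordinal_trans: "ordinal \<alpha> \<Longrightarrow> mem \<beta> \<alpha> \<Longrightarrow> mem \<gamma> \<beta> \<Longrightarrow> mem \<gamma> \<alpha>"
  unfolding ordinal_def transitive_set_def by blast

lemma ordinalI:
  "\<lbrakk>\<And>\<beta>. mem \<beta> \<alpha> \<Longrightarrow> ordinal \<beta>; \<And>\<beta> \<gamma>. \<lbrakk>mem \<beta> \<alpha>; mem \<gamma> \<beta>\<rbrakk> \<Longrightarrow> mem \<gamma> \<alpha>\<rbrakk> \<Longrightarrow> ordinal \<alpha>"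
  unfolding ordinal_def transitive_set_def by blast

lemma ordinal_succ: "ordinal \<alpha> \<Longrightarrow> ordinal (succ \<alpha>)"
  by (rule ordinalI) (auto dest: ordinal_mem ordinal_trans)

lemma ordinal_if_elts_eq_UN:
  assumes "elts \<beta> = (\<Union>i\<in>I. elts (\<alpha> i))" "\<And>i. i \<in> I \<Longrightarrow> ordinal (\<alpha> i)"
  shows "ordinal \<beta>"
  by (rule ordinalI) (use assms in \<open>auto dest: ordinal_mem ordinal_trans\<close>)

lemma ordinal_linear:
  fixes \<alpha> \<beta> :: "'v::zfc_universe"
  shows "\<lbrakk>ordinal \<alpha>; ordinal \<beta>\<rbrakk> \<Longrightarrow> mem \<alpha> \<beta> \<or> \<alpha> = \<beta> \<or> mem \<beta> \<alpha>"
proof (induction \<alpha> arbitrary: \<beta> rule: mem_induct)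
  case (step \<alpha>)
  note comparable = step.IH and ordinal_\<alpha> = step.prems(1)
  show ?case
    using step.prems(2)
  proof (induction \<beta> rule: mem_induct)
    case (step \<beta>)
    show ?case
    proof (rule ccontr)
      assume incomparable: "\<not> ?case"
      have "mem \<gamma> \<beta>" if "mem \<gamma> \<alpha>" for \<gamma>
        using comparable[OF that ordinal_mem[OF ordinal_\<alpha> that] step.prems] incomparable that
          ordinal_trans[OF ordinal_\<alpha>] by blast
      moreover have "mem \<gamma> \<alpha>" if "mem \<gamma> \<beta>" for \<gamma>
        using step.IH[OF that ordinal_mem[OF step.prems that]] incomparable that
          ordinal_trans[OF step.prems] by blast
      ultimately have "elts \<alpha> = elts \<beta>" by blast
      then show False
        using incomparable extensionality_ax by blast
    qed
  qed
qed

lemma ordinal_mem_or_subset: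
  fixes \<alpha> \<beta> :: "'v::zfc_universe"
  shows "\<lbrakk>ordinal \<alpha>; ordinal \<beta>\<rbrakk> \<Longrightarrow> mem \<alpha> \<beta> \<or> elts \<beta> \<subseteq> elts \<alpha>"
  using ordinal_linear ordinal_trans by blast

definition mem_order :: "'v::zfc_universe \<Rightarrow> ('v \<times> 'v) set" where
  "mem_order \<kappa> = {(\<alpha>, \<beta>). mem \<alpha> \<kappa> \<and> mem \<beta> \<kappa> \<and> (\<alpha> = \<beta> \<or> mem \<alpha> \<beta>)}"

lemma well_order_on_mem_order:
  assumes "ordinal \<kappa>"
  shows "well_order_on (elts \<kappa>) (mem_order \<kappa>)"
proof -
  have "ordinal \<alpha>" if "mem \<alpha> \<kappa>" for \<alpha>
    using assms that by (rule ordinal_mem)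
  then have "linear_order_on (elts \<kappa>) (mem_order \<kappa>)"
    unfolding mem_order_def linear_order_on_def partial_order_on_def preorder_on_def refl_on_def
      trans_def antisym_def total_on_def
    using ordinal_trans ordinal_linear not_mem_self by blast
  moreover have "wf (mem_order \<kappa> - Id)"
    by (rule wf_subset[OF wf_mem]) (auto simp: mem_order_def)
  ultimately show ?thesis
    unfolding well_order_on_def ..
qed

lemma lesspoll_ordinal_imp_eqpoll_mem:
  fixes \<kappa> :: "'v::zfc_universe"
  assumes "ordinal \<kappa>" "B \<prec> elts \<kappa>"
  shows "\<exists>\<alpha>\<in>elts \<kappa>. B \<approx> elts \<alpha>"
proof -
  let ?r = "mem_order \<kappa>"
  have well_order: "well_order_on (elts \<kappa>) ?r"
    using assms(1) by (rule well_order_on_mem_order)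
  then have field: "Field ?r = elts \<kappa>" and well: "Well_order ?r"
    using well_order_on_Field well_order_on_Well_order by blast+
  \<comment> \<open>The cardinal of \<open>B\<close>, as a well-order, is isomorphic to a proper initial segment of \<open>\<kappa>\<close>.\<close>
  have "(card_of B, card_of (elts \<kappa>)) \<in> ordLess"
    using assms(2) unfolding lesspoll_iff_not_lepoll lepoll_def card_of_ordLess .
  then have "(card_of B, ?r) \<in> ordLess"
    using card_of_least[OF well_order] by (rule ordLess_ordLeq_trans)
  then obtain \<alpha> where "mem \<alpha> \<kappa>" "(card_of B, Restr ?r (underS ?r \<alpha>)) \<in> ordIso"
    using ordLess_iff_ordIso_Restr[OF well card_of_Well_order] field by blast
  moreover have "Field (Restr ?r (underS ?r \<alpha>)) = underS ?r \<alpha>"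
    using well by (intro Refl_Field_Restr2 Order_Relation.underS_Field) (simp add: order_on_defs)
  moreover have "underS ?r \<alpha> = elts \<alpha>"
    using \<open>mem \<alpha> \<kappa>\<close> ordinal_trans[OF assms(1)] not_mem_self by (auto simp: underS_def mem_order_def)
  ultimately show ?thesis
    using card_of_cong[of "card_of B" "Restr ?r (underS ?r \<alpha>)"] Field_card_of[of B]
    unfolding eqpoll_iff_card_of_ordIso by auto
qed

lemma ordinal_class_two_least:
  fixes S :: "'v::zfc_universe set"
  assumes "\<And>\<alpha>. \<alpha> \<in> S \<Longrightarrow> ordinal \<alpha>" "\<alpha> \<in> S" "\<beta> \<in> S" "\<alpha> \<noteq> \<beta>"
  shows "\<exists>\<gamma>\<in>S. \<exists>\<delta>\<in>S. mem \<gamma> \<delta> \<and> S \<inter> elts \<delta> = {\<gamma>}"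
proof -
  have minimal: "\<exists>\<gamma>\<in>T. \<forall>\<alpha>\<in>T. \<not> mem \<alpha> \<gamma>" if "T \<noteq> {}" for T :: "'v set"
    using wf_mem[unfolded wf_eq_minimal, rule_format, of _ T] that by blast
  obtain \<gamma> where "\<gamma> \<in> S" and least: "\<forall>\<alpha>\<in>S. \<not> mem \<alpha> \<gamma>"
    using minimal[of S] assms(2) by blast
  obtain \<delta> where "\<delta> \<in> S - {\<gamma>}" and second: "\<forall>\<alpha>\<in>S - {\<gamma>}. \<not> mem \<alpha> \<delta>"
    using minimal[of "S - {\<gamma>}"] assms(2-4) by blast
  then have "mem \<gamma> \<delta>"
    using ordinal_linear[of \<gamma> \<delta>] assms(1) \<open>\<gamma> \<in> S\<close> least by blast
  then show ?thesis
    using \<open>\<gamma> \<in> S\<close> \<open>\<delta> \<in> S - {\<gamma>}\<close> second by blast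
qed


section \<open>The cumulative hierarchy\<close>

lemma Vset_eq_UN: "Vset \<alpha> = (\<Union>\<beta>\<in>elts \<alpha>. {x. elts x \<subseteq> Vset \<beta>})"
  using Vset_iff by blast

lemma Vset_mono: "elts \<alpha> \<subseteq> elts \<beta> \<Longrightarrow> Vset \<alpha> \<subseteq> Vset \<beta>"
  by (meson Vset_iff subset_iff)

lemma transitive_class_Vset: "transitive_class (Vset (\<alpha> :: 'v::zfc_universe))"
proof (induction \<alpha> rule: mem_induct)
  case (step \<alpha>)
  then show ?case
    unfolding transitive_class_def Vset_eq_UN[of \<alpha>] by blast
qed

lemma elts_subset_Vset: "ordinal \<alpha> \<Longrightarrow> elts \<alpha> \<subseteq> Vset (\<alpha> :: 'v::zfc_universe)"
proof (induction \<alpha> rule: mem_induct)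
  case (step \<alpha>)
  then show ?case
    by (meson Vset_iff ordinal_mem subsetI)
qed

lemma not_in_Vset_self: "\<alpha> \<notin> Vset (\<alpha> :: 'v::zfc_universe)"
proof (induction \<alpha> rule: mem_induct)
  case (step \<alpha>)
  then show ?case
    by (meson Vset_iff subsetD)
qed

lemma ordinal_in_Vset_iff:
  fixes \<alpha> \<beta> :: "'v::zfc_universe"
  assumes "ordinal \<alpha>" "ordinal \<beta>"
  shows "\<alpha> \<in> Vset \<beta> \<longleftrightarrow> mem \<alpha> \<beta>"
proof
  assume "\<alpha> \<in> Vset \<beta>"
  then show "mem \<alpha> \<beta>"
    using ordinal_mem_or_subset[OF assms] Vset_mono not_in_Vset_self by blast
qed (use elts_subset_Vset[OF assms(2)] in blast)

context grothendieck_universe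
begin

lemma Pow_closed:
  assumes "small_in N A"
  shows "small_in N {x. elts x \<subseteq> A}"
  using assms power_closed by (auto simp: small_in_def[of N A])

lemma Vset_closed: "\<alpha> \<in> N \<Longrightarrow> small_in N (Vset \<alpha>)"
proof (induction \<alpha> rule: mem_induct)
  case (step \<alpha>)
  then show ?case
    unfolding Vset_eq_UN[of \<alpha>] using mem_closed by (intro UN_closed Pow_closed) blast+
qed

lemma transitive_class_lepoll_subset:
  assumes "transitive_class T" "T \<lesssim> elts x" "x \<in> N"
  shows "T \<subseteq> N"
proof
  show "y \<in> T \<Longrightarrow> y \<in> N" for y
  proof (induction y rule: mem_induct)
    case (step y)
    then have "elts y \<subseteq> T" "elts y \<subseteq> N"
      using transitive_classD[OF assms(1)] by blast+
    then have "small_in N (elts y)"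
      using assms(2,3) lepoll_closed lepoll_trans subset_imp_lepoll by blast
    then show ?case by simp
  qed
qed

end

lemma small_in_Vset_iff:
  fixes \<alpha> :: "'v::zfc_universe"
  shows "small_in (Vset \<alpha>) A \<longleftrightarrow> (\<exists>\<beta>\<in>elts \<alpha>. A \<subseteq> Vset \<beta>)"
proof
  assume "\<exists>\<beta>\<in>elts \<alpha>. A \<subseteq> Vset \<beta>"
  then obtain \<beta> where "mem \<beta> \<alpha>" "A \<subseteq> Vset \<beta>"
    by blast
  moreover obtain v where "elts v = Vset \<beta>"
    using universe.Vset_closed[of \<beta>] by (auto simp: small_in_def)
  ultimately obtain x where "elts x = A"
    using universe.subset_closed[of v A] by (auto simp: small_in_def)
  with \<open>mem \<beta> \<alpha>\<close> \<open>A \<subseteq> Vset \<beta>\<close> show "small_in (Vset \<alpha>) A"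
    using Vset_iff unfolding small_in_def by blast
qed (use Vset_iff in \<open>auto simp: small_in_def\<close>)

lemma Vset_mono_mem: "ordinal \<alpha> \<Longrightarrow> mem \<beta> \<alpha> \<Longrightarrow> Vset \<beta> \<subseteq> Vset \<alpha>"
  by (intro Vset_mono) (auto dest: ordinal_trans)

lemma small_in_Vset_Vset_iff:
  fixes \<mu> \<theta> :: "'v::zfc_universe"
  assumes "ordinal \<mu>" "ordinal \<theta>"
  shows "small_in (Vset \<theta>) (Vset \<mu>) \<longleftrightarrow> mem \<mu> \<theta>"
proof
  assume "small_in (Vset \<theta>) (Vset \<mu>)"
  then obtain \<beta> where "mem \<beta> \<theta>" "Vset \<mu> \<subseteq> Vset \<beta>"
    unfolding small_in_Vset_iff by blast
  then have "\<mu> \<in> Vset \<theta>"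
    using elts_subset_Vset[OF assms(1)] Vset_iff by blast
  then show "mem \<mu> \<theta>"
    using ordinal_in_Vset_iff[OF assms] by blast
qed (auto simp: small_in_Vset_iff)


section \<open>Set-sized Grothendieck universes\<close>

locale set_universe = grothendieck_universe N for N :: "'v::zfc_universe set" +
  assumes small: "small N"
begin

definition height :: 'v where
  "height = set_of {\<alpha> \<in> N. ordinal \<alpha>}"

lemma elts_height: "elts height = {\<alpha> \<in> N. ordinal \<alpha>}"
proof -
  obtain n where "elts n = N"
    using small by (auto simp: small_in_def)
  then have "small {\<alpha> \<in> N. ordinal \<alpha>}"
    using universe.subset_closed[of n] by auto
  then show ?thesis
    by (simp add: height_def)
qed

lemma ordinal_height: "ordinal height"
  by (rule ordinalI) (auto simp: elts_height intro: mem_closed ordinal_mem)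

lemma lesspoll_height:
  assumes "x \<in> N"
  shows "elts x \<prec> elts height"
  unfolding lesspoll_iff_not_lepoll
proof
  assume "elts height \<lesssim> elts x"
  then have "small_in N (elts height)"
    by (intro lepoll_closed[OF assms]) (auto simp: elts_height)
  then have "mem height height"
    unfolding small_in_elts_iff using ordinal_height by (simp add: elts_height)
  then show False
    using not_mem_self by blast
qed

lemma bounded_in_height:
  assumes "x \<in> N" "f ` elts x \<subseteq> elts height"
  shows "\<exists>\<beta>\<in>elts height. f ` elts x \<subseteq> elts \<beta>"
proof -
  have f: "f y \<in> N" "ordinal (f y)" if "mem y x" for y
    using assms(2) that by (auto simp: elts_height)
  have "small_in N (\<Union>y\<in>elts x. elts (succ (f y)))"
    using f by (intro UN_closed[OF assms(1)]) (simp add: succ_closed del: elts_succ)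
  then obtain \<beta> where "\<beta> \<in> N" and \<beta>: "elts \<beta> = (\<Union>y\<in>elts x. elts (succ (f y)))"
    by (auto simp: small_in_def)
  moreover have "ordinal \<beta>"
    using f by (intro ordinal_if_elts_eq_UN[OF \<beta>] ordinal_succ)
  ultimately show ?thesis
    by (intro bexI[of _ \<beta>]) (auto simp: elts_height)
qed

lemma inaccessible_height: "inaccessible height"
proof -
  have cardinal: "cardinal height"
    using ordinal_height lesspoll_height by (simp add: cardinal_def elts_height)
  obtain w where "w \<in> N" "infinite (elts w)"
    using infinite by blast
  then have "(UNIV :: nat set) \<prec> elts height"
    using lesspoll_height infinite_le_lepoll lesspoll_trans1 by blast
  then have uncountable: "uncountable (elts height)"
    unfolding lesspoll_iff_not_lepoll countable_def lepoll_def by blast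
  moreover have "regular height"
    unfolding regular_def
  proof (intro conjI ballI allI impI cardinal)
    show "infinite (elts height)"
      using uncountable countable_finite by blast
    show "\<exists>\<beta>\<in>elts height. f ` elts \<alpha> \<subseteq> elts \<beta>"
      if "mem \<alpha> height" "f ` elts \<alpha> \<subseteq> elts height" for \<alpha> f
      using bounded_in_height that by (simp add: elts_height)
  qed
  moreover have "strong_limit height"
    unfolding strong_limit_def
  proof (intro conjI ballI cardinal)
    fix \<alpha> assume "mem \<alpha> height"
    then obtain p where "p \<in> N" and p: "elts p = {z. elts z \<subseteq> elts \<alpha>}"
      using power_closed[of \<alpha>] by (auto simp: elts_height small_in_def)
    have "A \<in> elts ` elts p" if "A \<subseteq> elts \<alpha>" for A
      using universe.subset_closed[OF UNIV_I that] that by (auto simp: p small_in_def)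
    then have "Pow (elts \<alpha>) \<lesssim> elts p"
      by (intro subset_image_lepoll) blast
    then show "Pow (elts \<alpha>) \<prec> elts height"
      using lesspoll_height[OF \<open>p \<in> N\<close>] by (rule lesspoll_trans1)
  qed
  ultimately show ?thesis
    by (simp add: inaccessible_def)
qed

lemma eq_Vset_height: "N = Vset height"
proof
  have "x \<in> N \<Longrightarrow> x \<in> Vset height" for x
  proof (induction x rule: mem_induct)
    case (step x)
    then have "\<forall>y\<in>elts x. \<exists>\<beta>\<in>elts height. elts y \<subseteq> Vset \<beta>"
      using mem_closed Vset_iff by blast
    then obtain g where g: "\<And>y. mem y x \<Longrightarrow> mem (g y) height \<and> elts y \<subseteq> Vset (g y)"
      by metis
    then obtain \<beta> where "mem \<beta> height" and \<beta>: "g ` elts x \<subseteq> elts \<beta>"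
      using bounded_in_height[of x g] step.prems by blast
    have "y \<in> Vset \<beta>" if "mem y x" for y
      using g[OF that] \<beta> that by (subst Vset_iff) blast
    with \<open>mem \<beta> height\<close> show ?case
      by (subst Vset_iff) blast
  qed
  then show "N \<subseteq> Vset height" by blast
  show "Vset height \<subseteq> N"
  proof
    fix x assume "x \<in> Vset height"
    then obtain \<beta> where "mem \<beta> height" "elts x \<subseteq> Vset \<beta>"
      using Vset_iff by blast
    moreover from this obtain v where "v \<in> N" "elts v = Vset \<beta>"
      using Vset_closed[of \<beta>] by (auto simp: elts_height small_in_def)
    ultimately show "x \<in> N"
      using subset_closed[of v "elts x"] by simp
  qed
qed

end


section \<open>Inaccessible cardinals\<close>

lemma regular_bounded:
  fixes \<kappa> :: "'v::zfc_universe"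
  assumes "regular \<kappa>" "A \<subseteq> elts \<kappa>" "A \<prec> elts \<kappa>"
  shows "\<exists>\<beta>\<in>elts \<kappa>. A \<subseteq> elts \<beta>"
proof -
  have "ordinal \<kappa>"
    using assms(1) by (simp add: regular_def cardinal_def)
  then obtain \<alpha> where "mem \<alpha> \<kappa>" "A \<approx> elts \<alpha>"
    using lesspoll_ordinal_imp_eqpoll_mem assms(3) by blast
  then obtain f where "f ` elts \<alpha> = A"
    using eqpoll_sym unfolding eqpoll_def bij_betw_def by metis
  then show ?thesis
    using assms(1,2) \<open>mem \<alpha> \<kappa>\<close> unfolding regular_def by blast
qed

lemma regular_common_bound:
  fixes \<kappa> :: "'v::zfc_universe"
  assumes "regular \<kappa>" "I \<prec> elts \<kappa>" and A: "\<And>i. i \<in> I \<Longrightarrow> A i \<prec> elts \<kappa>"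
  shows "\<exists>\<epsilon>\<in>elts \<kappa>. I \<lesssim> elts \<epsilon> \<and> (\<forall>i\<in>I. A i \<lesssim> elts \<epsilon>)"
proof -
  have ordinal: "ordinal \<kappa>" and infinite: "infinite (elts \<kappa>)"
    using assms(1) by (simp_all add: regular_def cardinal_def)
  obtain g where g: "\<And>i. i \<in> I \<Longrightarrow> mem (g i) \<kappa> \<and> A i \<approx> elts (g i)"
    using lesspoll_ordinal_imp_eqpoll_mem[OF ordinal A] by metis
  then have "g ` I \<subseteq> elts \<kappa>" "g ` I \<prec> elts \<kappa>"
    using assms(2) image_lepoll lesspoll_trans1 by blast+
  then obtain \<delta> where "mem \<delta> \<kappa>" and \<delta>: "g ` I \<subseteq> elts \<delta>"
    using regular_bounded[OF assms(1)] by blast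
  obtain \<alpha> where "mem \<alpha> \<kappa>" and \<alpha>: "I \<approx> elts \<alpha>"
    using lesspoll_ordinal_imp_eqpoll_mem[OF ordinal assms(2)] by blast
  have "{\<alpha>, \<delta>} \<prec> elts \<kappa>"
    using infinite by (simp add: finite_lesspoll_infinite)
  then obtain \<epsilon> where "mem \<epsilon> \<kappa>" "mem \<alpha> \<epsilon>" "mem \<delta> \<epsilon>"
    using regular_bounded[OF assms(1), of "{\<alpha>, \<delta>}"] \<open>mem \<alpha> \<kappa>\<close> \<open>mem \<delta> \<kappa>\<close> by auto
  then have subset: "elts \<gamma> \<subseteq> elts \<epsilon>" if "mem \<gamma> \<epsilon>" for \<gamma>
    using ordinal_trans ordinal_mem[OF ordinal] that by blast
  have "I \<lesssim> elts \<epsilon>"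
    using lepoll_trans1[OF \<alpha> subset_imp_lepoll] subset[OF \<open>mem \<alpha> \<epsilon>\<close>] by blast
  moreover have "A i \<lesssim> elts \<epsilon>" if "i \<in> I" for i
  proof -
    have "elts (g i) \<subseteq> elts \<epsilon>"
      using \<delta> subset subset[OF \<open>mem \<delta> \<epsilon>\<close>] that by blast
    then show ?thesis
      using g[OF that] lepoll_trans1 subset_imp_lepoll by blast
  qed
  ultimately show ?thesis
    using \<open>mem \<epsilon> \<kappa>\<close> by blast
qed

lemma regular_UN_lesspoll:
  fixes \<kappa> :: "'v::zfc_universe"
  assumes "regular \<kappa>" "I \<prec> elts \<kappa>" "\<And>i. i \<in> I \<Longrightarrow> A i \<prec> elts \<kappa>"
  shows "(\<Union>i\<in>I. A i) \<prec> elts \<kappa>"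
proof -
  obtain \<epsilon> where "mem \<epsilon> \<kappa>" and I: "I \<lesssim> elts \<epsilon>" and A: "\<And>i. i \<in> I \<Longrightarrow> A i \<lesssim> elts \<epsilon>"
    using regular_common_bound[OF assms(1,2), of A] assms(3) by blast
  show ?thesis
  proof (cases "finite (elts \<epsilon>)")
    case True
    then have "finite (\<Union>i\<in>I. A i)"
      using I A by (blast intro: lepoll_finite)
    then show ?thesis
      using assms(1) by (simp add: regular_def finite_lesspoll_infinite)
  next
    case False
    then have "(\<Union>i\<in>I. A i) \<lesssim> elts \<epsilon>"
      using I A by (rule lepoll_UNION)
    moreover have "elts \<epsilon> \<prec> elts \<kappa>"
      using assms(1) \<open>mem \<epsilon> \<kappa>\<close> by (simp add: regular_def cardinal_def)
    ultimately show ?thesis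
      by (rule lesspoll_trans1)
  qed
qed

lemma strong_limit_Pow_lesspoll:
  fixes \<kappa> :: "'v::zfc_universe"
  assumes "strong_limit \<kappa>" "A \<prec> elts \<kappa>"
  shows "Pow A \<prec> elts \<kappa>"
proof -
  have "ordinal \<kappa>"
    using assms(1) by (simp add: strong_limit_def cardinal_def)
  then obtain \<alpha> where "mem \<alpha> \<kappa>" "A \<approx> elts \<alpha>"
    using lesspoll_ordinal_imp_eqpoll_mem assms(2) by blast
  then have "Pow A \<lesssim> Pow (elts \<alpha>)" "Pow (elts \<alpha>) \<prec> elts \<kappa>"
    using assms(1) by (auto simp: strong_limit_def lepoll_Pow_mono eqpoll_imp_lepoll)
  then show ?thesis
    by (rule lesspoll_trans1)
qed

lemma inaccessible_imp_ordinal: "inaccessible \<kappa> \<Longrightarrow> ordinal \<kappa>"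
  by (simp add: inaccessible_def regular_def cardinal_def)

lemma inaccessible_Vset_lesspoll:
  fixes \<kappa> :: "'v::zfc_universe"
  assumes "inaccessible \<kappa>"
  shows "mem \<beta> \<kappa> \<Longrightarrow> Vset \<beta> \<prec> elts \<kappa>"
proof (induction \<beta> rule: mem_induct)
  case (step \<beta>)
  have regular: "regular \<kappa>" and strong_limit: "strong_limit \<kappa>"
    and cardinal: "cardinal \<kappa>" and ordinal: "ordinal \<kappa>"
    using assms by (auto simp: inaccessible_def regular_def cardinal_def)
  show ?case
    unfolding Vset_eq_UN[of \<beta>]
  proof (rule regular_UN_lesspoll[OF regular])
    show "elts \<beta> \<prec> elts \<kappa>"
      using cardinal step.prems by (simp add: cardinal_def)
    fix \<gamma> assume "mem \<gamma> \<beta>"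
    then have "Vset \<gamma> \<prec> elts \<kappa>"
      using step ordinal_trans[OF ordinal] by blast
    then have "Pow (Vset \<gamma>) \<prec> elts \<kappa>"
      by (rule strong_limit_Pow_lesspoll[OF strong_limit])
    moreover have "{x. elts x \<subseteq> Vset \<gamma>} \<lesssim> Pow (Vset \<gamma>)"
      unfolding lepoll_def by (intro exI[of _ elts]) (auto intro!: inj_onI extensionality_ax)
    ultimately show "{x. elts x \<subseteq> Vset \<gamma>} \<prec> elts \<kappa>"
      by (rule lesspoll_trans1[rotated])
  qed
qed

lemma inaccessible_infinite_mem:
  fixes \<kappa> :: "'v::zfc_universe"
  assumes "inaccessible \<kappa>"
  shows "\<exists>\<alpha>\<in>elts \<kappa>. infinite (elts \<alpha>)"
proof -
  have "(UNIV :: nat set) \<prec> elts \<kappa>"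
    using assms unfolding inaccessible_def lesspoll_iff_not_lepoll countable_def lepoll_def by blast
  then obtain \<alpha> where "mem \<alpha> \<kappa>" "(UNIV :: nat set) \<approx> elts \<alpha>"
    using lesspoll_ordinal_imp_eqpoll_mem inaccessible_imp_ordinal[OF assms] by blast
  then show ?thesis
    using infinite_le_lepoll eqpoll_imp_lepoll by blast
qed

lemma regular_power_small_in_Vset:
  fixes \<kappa> :: "'v::zfc_universe"
  assumes "regular \<kappa>" "x \<in> Vset \<kappa>"
  shows "small_in (Vset \<kappa>) {z. elts z \<subseteq> elts x}"
proof -
  obtain \<beta> where "mem \<beta> \<kappa>" "elts x \<subseteq> Vset \<beta>"
    using assms(2) Vset_iff by blast
  moreover have "{\<beta>} \<prec> elts \<kappa>"
    using assms(1) by (simp add: regular_def finite_lesspoll_infinite)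
  ultimately obtain \<gamma> where "mem \<gamma> \<kappa>" "mem \<beta> \<gamma>"
    using regular_bounded[OF assms(1), of "{\<beta>}"] by auto
  then show ?thesis
    unfolding small_in_Vset_iff using \<open>elts x \<subseteq> Vset \<beta>\<close> Vset_iff by blast
qed

lemma inaccessible_UN_small_in_Vset:
  fixes \<kappa> :: "'v::zfc_universe"
  assumes "inaccessible \<kappa>" "x \<in> Vset \<kappa>"
    and F: "\<And>y. mem y x \<Longrightarrow> small_in (Vset \<kappa>) (F y)"
  shows "small_in (Vset \<kappa>) (\<Union>y\<in>elts x. F y)"
proof -
  have regular: "regular \<kappa>" and ordinal: "ordinal \<kappa>"
    using assms(1) by (simp_all add: inaccessible_def inaccessible_imp_ordinal)
  obtain g where g: "\<And>y. mem y x \<Longrightarrow> mem (g y) \<kappa> \<and> F y \<subseteq> Vset (g y)"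
    using F unfolding small_in_Vset_iff by metis
  obtain \<beta> where "mem \<beta> \<kappa>" "elts x \<subseteq> Vset \<beta>"
    using assms(2) Vset_iff by blast
  then have "elts x \<prec> elts \<kappa>"
    using inaccessible_Vset_lesspoll[OF assms(1)] subset_imp_lepoll lesspoll_trans1 by blast
  then have "g ` elts x \<prec> elts \<kappa>"
    by (rule lesspoll_trans1[OF image_lepoll])
  then obtain \<gamma> where "mem \<gamma> \<kappa>" "g ` elts x \<subseteq> elts \<gamma>"
    using regular_bounded[OF regular, of "g ` elts x"] g by blast
  then have "F y \<subseteq> Vset \<gamma>" if "mem y x" for y
    using g[OF that] Vset_mono_mem[OF ordinal_mem[OF ordinal]] that by blast
  then show ?thesis
    unfolding small_in_Vset_iff using \<open>mem \<gamma> \<kappa>\<close> by blast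
qed

lemma grothendieck_universe_Vset:
  fixes \<kappa> :: "'v::zfc_universe"
  assumes "inaccessible \<kappa>"
  shows "grothendieck_universe (Vset \<kappa>)"
proof
  show "transitive_class (Vset \<kappa>)"
    by (rule transitive_class_Vset)
  show "small_in (Vset \<kappa>) {z. elts z \<subseteq> elts x}" if "x \<in> Vset \<kappa>" for x
    using assms that by (simp add: inaccessible_def regular_power_small_in_Vset)
  show "small_in (Vset \<kappa>) (\<Union>y\<in>elts x. F y)"
    if "x \<in> Vset \<kappa>" "\<And>y. mem y x \<Longrightarrow> small_in (Vset \<kappa>) (F y)" for x F
    using assms that by (rule inaccessible_UN_small_in_Vset)
  show "\<exists>x\<in>Vset \<kappa>. infinite (elts x)"
    using inaccessible_infinite_mem elts_subset_Vset[OF inaccessible_imp_ordinal] assms by blast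
qed


section \<open>Invariance under isomorphism\<close>

context
  fixes f :: "'m \<Rightarrow> 'n" and M N E F
  assumes bij: "bij_betw f M N"
    and iso: "\<And>x y. \<lbrakk>x \<in> M; y \<in> M\<rbrakk> \<Longrightarrow> E x y \<longleftrightarrow> F (f x) (f y)"
begin

lemma relations_image: "relations N n = (`) (map f) ` relations M n"
proof -
  have relations_eq: "relations X n = Pow {xs \<in> lists X. length xs = n}" for X :: "'c set"
    unfolding relations_def lists_eq_set by (intro arg_cong[of _ _ Pow]) auto
  have "lists N = map f ` lists M"
    using lists_image[of f M] bij_betw_imp_surj_on[OF bij] by simp
  then have "{ys \<in> lists N. length ys = n} = map f ` {xs \<in> lists M. length xs = n}"
    by auto
  then show ?thesis
    unfolding relations_eq by (simp only: image_Pow_surj)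
qed

lemma sat_iso:
  "\<lbrakk>\<And>x. s x \<in> M; \<And>n X. r (n, X) \<in> relations M n\<rbrakk> \<Longrightarrow>
    sat N F (f \<circ> s) ((`) (map f) \<circ> r) \<phi> \<longleftrightarrow> sat M E s r \<phi>"
proof (induction \<phi> arbitrary: s r)
  case (Rel X xs)
  have "inj_on (map f) (lists M)"
    using bij by (simp add: bij_betw_def inj_on_map_lists)
  moreover have "map s xs \<in> lists M" "r (length xs, X) \<subseteq> lists M"
    using Rel(1) Rel(2)[of "length xs" X] by (auto simp: relations_def in_lists_conv_set)
  ultimately have "map f (map s xs) \<in> map f ` r (length xs, X) \<longleftrightarrow> map s xs \<in> r (length xs, X)"
    by (rule inj_on_image_mem_iff)
  then show ?case
    by (simp add: comp_def)
next
  case (Forall x \<phi>)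
  have "sat N F ((f \<circ> s)(x := f a)) ((`) (map f) \<circ> r) \<phi> \<longleftrightarrow> sat M E (s(x := a)) r \<phi>"
    if "a \<in> M" for a
    unfolding fun_upd_comp[symmetric] by (rule Forall.IH) (use Forall.prems that in auto)
  then show ?case
    by (simp add: bij_betw_imp_surj_on[OF bij, symmetric] comp_def)
next
  case (Forall2 n X \<phi>)
  have "sat N F (f \<circ> s) (((`) (map f) \<circ> r)((n, X) := map f ` A)) \<phi> \<longleftrightarrow>
      sat M E s (r((n, X) := A)) \<phi>" if "A \<in> relations M n" for A
    unfolding fun_upd_comp[symmetric] by (rule Forall2.IH) (use Forall2.prems that in auto)
  then show ?case
    by (simp add: relations_image comp_def)
qed (simp_all add: iso inj_on_eq_iff[OF bij_betw_imp_inj_on[OF bij]])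

lemma models_iso:
  assumes "models M E T"
  shows "models N F T"
  unfolding models_def
proof (intro conjI ballI allI impI)
  show "N \<noteq> {}"
    using assms bij by (auto simp: models_def bij_betw_def)
next
  fix \<phi> and s' :: "nat \<Rightarrow> 'n" and r' :: "nat \<times> nat \<Rightarrow> 'n list set"
  assume "\<phi> \<in> T" and s': "\<forall>x. s' x \<in> N" and r': "\<forall>n X. r' (n, X) \<in> relations N n"
  have "\<forall>x. \<exists>a\<in>M. s' x = f a"
    using s' bij by (auto simp: bij_betw_def)
  then obtain s where s: "\<And>x. s x \<in> M \<and> s' x = f (s x)"
    by metis
  have "\<forall>p. \<exists>A\<in>relations M (fst p). r' p = map f ` A"
    using r' relations_image by (metis imageE prod.collapse)
  then obtain r where r: "\<And>p. r p \<in> relations M (fst p) \<and> r' p = map f ` r p"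
    by metis
  have r_relations: "r (n, X) \<in> relations M n" for n X
    using r[of "(n, X)"] by simp
  then have "sat M E s r \<phi>"
    using assms \<open>\<phi> \<in> T\<close> s by (simp add: models_def)
  then have "sat N F (f \<circ> s) ((`) (map f) \<circ> r) \<phi>"
    using s r_relations by (simp only: sat_iso)
  moreover have "s' = f \<circ> s" "r' = (`) (map f) \<circ> r"
    using s r by auto
  ultimately show "sat N F s' r' \<phi>"
    by simp
qed

end

lemma isomorphic_models:
  assumes "isomorphic M E N F" "models M E T"
  shows "models N F T"
  using assms models_iso unfolding isomorphic_def by metis


section \<open>Categoricity\<close>

theorem zermelo_quasi_categoricity:
  fixes v :: "'v::zfc_universe"
  assumes "models M E ZFC2" "M \<lesssim> elts v"
  shows "\<exists>\<mu>::'v. inaccessible \<mu> \<and> isomorphic M E (Vset \<mu>) mem"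
proof -
  interpret zfc2_structure M E
    using assms(1) models_ZFC2_iff by blast
  have "x = y" if "x \<in> M" "y \<in> M" "\<And>z. (z, x) \<in> mem_rel \<longleftrightarrow> (z, y) \<in> mem_rel" for x y
    using extensionality that by (auto simp: mem_rel_def)
  then obtain N :: "'v set" where "small N" "transitive_class N"
    and "isomorphic M (\<lambda>x y. (x, y) \<in> mem_rel) N mem"
    using mostowski_collapse[OF wf_mem_rel _ assms(2)] by (auto simp: mem_rel_def)
  then have iso: "isomorphic M E N mem"
    by (auto simp: isomorphic_def mem_rel_def)
  then have "models N mem ZFC2"
    using assms(1) by (rule isomorphic_models)
  then interpret N: set_universe N
    using transitive_models_ZFC2_iff[OF \<open>transitive_class N\<close>] \<open>small N\<close>
    by (simp add: set_universe_def set_universe_axioms_def)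
  show ?thesis
    using iso N.inaccessible_height N.eq_Vset_height by metis
qed

lemma models_ZFC2_Vset: "inaccessible \<kappa> \<Longrightarrow> models (Vset \<kappa>) mem ZFC2"
  using transitive_models_ZFC2_iff transitive_class_Vset grothendieck_universe_Vset by blast

lemma models_Un: "models M E (S \<union> T) \<longleftrightarrow> models M E S \<and> models M E T"
  unfolding models_def by blast

lemma (in grothendieck_universe) categorically_characterizes_inI:
  assumes "inaccessible \<kappa>" "models (Vset \<kappa>) mem \<Sigma>" "small_in N (Vset \<kappa>)"
    and unique: "\<And>\<mu>. \<lbrakk>inaccessible \<mu>; models (Vset \<mu>) mem \<Sigma>; small_in N (Vset \<mu>)\<rbrakk> \<Longrightarrow> \<mu> = \<kappa>"
  shows "categorically_characterizes_in N \<Sigma> \<kappa>"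
  unfolding categorically_characterizes_in_def
proof (intro conjI ballI allI impI)
  show "\<exists>v\<in>N. elts v = Vset \<kappa>"
    using assms(3) by (simp add: small_in_def)
  show "models (Vset \<kappa>) mem (ZFC2 \<union> \<Sigma>)"
    using assms(1,2) by (simp add: models_Un models_ZFC2_Vset)
  fix m E assume "m \<in> N" and model: "models (elts m) E (ZFC2 \<union> \<Sigma>)"
  then obtain \<mu> :: 'v where "inaccessible \<mu>" and iso: "isomorphic (elts m) E (Vset \<mu>) mem"
    using zermelo_quasi_categoricity[of "elts m" E m] by (auto simp: models_Un)
  moreover have "models (Vset \<mu>) mem \<Sigma>"
    using isomorphic_models[OF iso] model by (simp add: models_Un)
  moreover have "Vset \<mu> \<lesssim> elts m"
    using iso unfolding isomorphic_def by (meson eqpoll_def eqpoll_imp_lepoll eqpoll_sym)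
  then have "small_in N (Vset \<mu>)"
    using transitive_class_lepoll_subset[OF transitive_class_Vset] lepoll_closed \<open>m \<in> N\<close> by blast
  ultimately show "isomorphic (elts m) E (Vset \<kappa>) mem"
    using unique by blast
qed

lemma categorically_characterizes_in_VsetI:
  fixes \<kappa> \<theta> :: "'v::zfc_universe"
  assumes "inaccessible \<kappa>" "inaccessible \<theta>" "mem \<kappa> \<theta>" "models (Vset \<kappa>) mem \<Sigma>"
    and unique: "\<And>\<mu>. \<lbrakk>inaccessible \<mu>; models (Vset \<mu>) mem \<Sigma>; mem \<mu> \<theta>\<rbrakk> \<Longrightarrow> \<mu> = \<kappa>"
  shows "categorically_characterizes_in (Vset \<theta>) \<Sigma> \<kappa>"
proof -
  interpret grothendieck_universe "Vset \<theta>"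
    using assms(2) by (rule grothendieck_universe_Vset)
  have small_in_iff: "small_in (Vset \<theta>) (Vset \<mu>) \<longleftrightarrow> mem \<mu> \<theta>" if "inaccessible \<mu>" for \<mu>
    using that assms(2) by (intro small_in_Vset_Vset_iff inaccessible_imp_ordinal)
  show ?thesis
    by (rule categorically_characterizes_inI) (use assms small_in_iff in blast)+
qed

theorem theorem6:
  fixes \<Sigma> :: "fm set" and \<kappa> :: "'v::zfc_universe"
  assumes "\<forall>\<sigma>\<in>\<Sigma>. sentence \<sigma>"
    and "inaccessible \<kappa>"
    and "models (Vset \<kappa>) mem \<Sigma>"
  shows "(categorically_characterizes_in UNIV \<Sigma> \<kappa> \<and>
          (\<forall>\<mu>::'v. inaccessible \<mu> \<and> models (Vset \<mu>) mem \<Sigma> \<longrightarrow> \<mu> = \<kappa>))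
       \<or> (\<exists>\<kappa>' \<theta>::'v. inaccessible \<kappa>' \<and> inaccessible \<theta> \<and> \<kappa>' \<in> elts \<theta> \<and>
            models (Vset \<kappa>') mem \<Sigma> \<and>
            (\<forall>\<mu>\<in>elts \<theta>. inaccessible \<mu> \<and> models (Vset \<mu>) mem \<Sigma> \<longrightarrow> \<mu> = \<kappa>') \<and>
            models (Vset \<theta>) mem ZFC2 \<and>
            categorically_characterizes_in (Vset \<theta>) \<Sigma> \<kappa>')"
proof (cases "\<forall>\<mu>::'v. inaccessible \<mu> \<and> models (Vset \<mu>) mem \<Sigma> \<longrightarrow> \<mu> = \<kappa>")
  case True
  have "categorically_characterizes_in UNIV \<Sigma> \<kappa>"
    by (rule universe.categorically_characterizes_inI[OF assms(2,3)])
      (simp_all add: True universe.Vset_closed)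
  with True show ?thesis by blast
next
  case False
  define S where "S = {\<mu>::'v. inaccessible \<mu> \<and> models (Vset \<mu>) mem \<Sigma>}"
  obtain \<kappa>' \<theta> where "\<kappa>' \<in> S" "\<theta> \<in> S" "mem \<kappa>' \<theta>" and least: "S \<inter> elts \<theta> = {\<kappa>'}"
    using ordinal_class_two_least[of S \<kappa>] inaccessible_imp_ordinal assms(2,3) False
    unfolding S_def by blast
  have unique: "\<mu> = \<kappa>'" if "inaccessible \<mu>" "models (Vset \<mu>) mem \<Sigma>" "mem \<mu> \<theta>" for \<mu>
    using least that unfolding S_def by blast
  have "inaccessible \<kappa>'" "inaccessible \<theta>" "models (Vset \<kappa>') mem \<Sigma>"
    using \<open>\<kappa>' \<in> S\<close> \<open>\<theta> \<in> S\<close> by (simp_all add: S_def)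
  moreover from this have "categorically_characterizes_in (Vset \<theta>) \<Sigma> \<kappa>'"
    using \<open>mem \<kappa>' \<theta>\<close> unique by (intro categorically_characterizes_in_VsetI)
  ultimately show ?thesis
    using models_ZFC2_Vset unique \<open>mem \<kappa>' \<theta>\<close> by blast
qed

end
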